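(* Let $d\ge1$, let $\mathcal X\subset\mathbb R^d$ be non-empty and compact, let $\|\cdot\|$ be a norm on $\mathbb R^d$, let $L>0$, and let $\varepsilon_0:=L\max_{x,y\in\mathcal X}\|x-y\|$. Let $f\in\mathcal F_L$ with maximizer $x^\star$. Suppose that there exist $r_0>\varepsilon_0/(2L)$ and $\gamma\in(0,1]$ such that $\mathrm{vol}(B_r(x)\cap\mathcal X)\ge\gamma v_r$ for all $x\in\mathcal X$ and all $r\in(0,r_0)$. Then there exist $c_d,C_d>0$ (e.g., $c_d:=1/v_{1/L}$ and $C_d:=1/(\gamma v_{1/(128L)})$) such that, for all $\varepsilon\in(0,\varepsilon_0]$, $$c_d\int_{\mathcal X}\frac{\mathrm dx}{(f(x^\star)-f(x)+\varepsilon)^d}\;\le\;S_{\mathrm C}(f,\varepsilon)\;\le\;C_d\int_{\mathcal X}\frac{\mathrm dx}{(f(x^\star)-f(x)+\varepsilon)^d}.$$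
   Context: $B_\rho(x)$ is the closed $\|\cdot\|$-ball of radius $\rho$ centered at $x$, $\mathrm{vol}$ is Lebesgue measure, and $v_\rho:=\mathrm{vol}(B_\rho(0))$. For Lipschitz $g:\mathcal X\to\mathbb R$, $\mathrm{Lip}(g)$ is its smallest Lipschitz constant with respect to $\|\cdot\|$; $\mathcal F_L:=\{g:\mathcal X\to\mathbb R\mid g\text{ Lipschitz and }\mathrm{Lip}(g)<L\}$. For $\varepsilon>0$, $\mathcal X_\varepsilon:=\{x\in\mathcal X:\max(f)-f(x)\le\varepsilon\}$, and for $0\le a<b$, $\mathcal X_{(a,b]}:=\{x\in\mathcal X:a<\max(f)-f(x)\le b\}$. For bounded $E\subset\mathbb R^d$ and $r>0$, the packing number is $\mathcal N(E,r):=\sup\{k\ge1:\exists x_1,\dots,x_k\in E,\ \min_{i\ne j}\|x_i-x_j\|>r\}$ if $E\neq\varnothing$, and $0$ if $E=\varnothing$. For $\varepsilon\in(0,\varepsilon_0]$ let $m_\varepsilon:=\lceil\log_2(\varepsilon_0/\varepsilon)\rceil$, $\varepsilon_{m_\varepsilon}:=\varepsilon$, $\varepsilon_k:=\varepsilon_02^{-k}$ for $0\le k\le m_\varepsilon-1$, and $$S_{\mathrm C}(f,\varepsilon):=\mathcal N\left(\mathcal X_\varepsilon,\frac{\varepsilon}{L}\right)+\sum_{k=1}^{m_\varepsilon}\mathcal N\left(\mathcal X_{(\varepsilon_k,\varepsilon_{k-1}]},\frac{\varepsilon_k}{L}\right).$$ *)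

theory Defs
  imports "HOL-Analysis.Analysis"
begin

text \<open>
  The ambient space is \<^typ>\<open>real ^ 'n\<close>, of dimension \<open>CARD('n)\<close>. The norm is an arbitrary one and is
  passed as a parameter \<open>nrm\<close>; it need not be the Euclidean \<^const>\<open>norm\<close> of the type, so the
  metric notions of the library (balls, Lipschitz continuity, diameter) do not apply to it.
  A function on \<open>X\<close> is represented by a function on the whole space; only its values on \<open>X\<close> are used.
\<close>

definition is_norm :: "(real ^ 'n \<Rightarrow> real) \<Rightarrow> bool" where
  "is_norm nrm \<longleftrightarrow>
     (\<forall>x. nrm x \<ge> 0) \<and>
     (\<forall>x. nrm x = 0 \<longleftrightarrow> x = 0) \<and>
     (\<forall>a x. nrm (a *\<^sub>R x) = \<bar>a\<bar> * nrm x) \<and>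
     (\<forall>x y. nrm (x + y) \<le> nrm x + nrm y)"

definition nball :: "(real ^ 'n \<Rightarrow> real) \<Rightarrow> real ^ 'n \<Rightarrow> real \<Rightarrow> (real ^ 'n) set" where
  "nball nrm x r = {y. nrm (y - x) \<le> r}"

definition vol :: "(real ^ 'n) set \<Rightarrow> real" where
  "vol A = measure lebesgue A"

definition ball_vol :: "(real ^ 'n \<Rightarrow> real) \<Rightarrow> real \<Rightarrow> real" where
  "ball_vol nrm r = vol (nball nrm 0 r)"

definition max_on :: "('a \<Rightarrow> real) \<Rightarrow> 'a set \<Rightarrow> real" where
  "max_on g A = (GREATEST v. v \<in> g ` A)"

definition lipschitz_bound ::
    "(real ^ 'n \<Rightarrow> real) \<Rightarrow> (real ^ 'n) set \<Rightarrow> (real ^ 'n \<Rightarrow> real) \<Rightarrow> real \<Rightarrow> bool" where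
  "lipschitz_bound nrm X g K \<longleftrightarrow>
     K \<ge> 0 \<and> (\<forall>x\<in>X. \<forall>y\<in>X. \<bar>g x - g y\<bar> \<le> K * nrm (x - y))"

definition Lip :: "(real ^ 'n \<Rightarrow> real) \<Rightarrow> (real ^ 'n) set \<Rightarrow> (real ^ 'n \<Rightarrow> real) \<Rightarrow> real" where
  "Lip nrm X g = (LEAST K. lipschitz_bound nrm X g K)"

definition lip_class ::
    "(real ^ 'n \<Rightarrow> real) \<Rightarrow> (real ^ 'n) set \<Rightarrow> real \<Rightarrow> (real ^ 'n \<Rightarrow> real) set" where
  "lip_class nrm X L = {g. (\<exists>K. lipschitz_bound nrm X g K) \<and> Lip nrm X g < L}"

definition near_opt :: "(real ^ 'n) set \<Rightarrow> (real ^ 'n \<Rightarrow> real) \<Rightarrow> real \<Rightarrow> (real ^ 'n) set" where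
  "near_opt X f e = {x \<in> X. max_on f X - f x \<le> e}"

definition layer ::
    "(real ^ 'n) set \<Rightarrow> (real ^ 'n \<Rightarrow> real) \<Rightarrow> real \<Rightarrow> real \<Rightarrow> (real ^ 'n) set" where
  "layer X f a b = {x \<in> X. a < max_on f X - f x \<and> max_on f X - f x \<le> b}"

text \<open>
  For \<open>k = 1\<close> the separation condition is void (a minimum over the empty set is infinite). The
  packing number is only used for bounded \<open>E\<close> and \<open>r > 0\<close>, where the set of admissible \<open>k\<close> is finite.
\<close>

definition packing_number :: "(real ^ 'n \<Rightarrow> real) \<Rightarrow> (real ^ 'n) set \<Rightarrow> real \<Rightarrow> nat" where
  "packing_number nrm E r =
     (if E = {} then 0
      else Sup {k. k \<ge> 1 \<and> (\<exists>x :: nat \<Rightarrow> real ^ 'n.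
                  (\<forall>i\<in>{1..k}. x i \<in> E) \<and>
                  (\<forall>i\<in>{1..k}. \<forall>j\<in>{1..k}. i \<noteq> j \<longrightarrow> nrm (x i - x j) > r))})"

definition eps0 :: "(real ^ 'n \<Rightarrow> real) \<Rightarrow> (real ^ 'n) set \<Rightarrow> real \<Rightarrow> real" where
  "eps0 nrm X L = L * max_on (\<lambda>(x, y). nrm (x - y)) (X \<times> X)"

definition num_layers :: "real \<Rightarrow> real \<Rightarrow> nat" where
  "num_layers e0 e = nat \<lceil>log 2 (e0 / e)\<rceil>"

definition eps_seq :: "real \<Rightarrow> real \<Rightarrow> nat \<Rightarrow> real" where
  "eps_seq e0 e k = (if k < num_layers e0 e then e0 / 2 ^ k else e)"

definition S_C ::
    "(real ^ 'n \<Rightarrow> real) \<Rightarrow> (real ^ 'n) set \<Rightarrow> real \<Rightarrow> (real ^ 'n \<Rightarrow> real) \<Rightarrow> real \<Rightarrow> nat" where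
  "S_C nrm X L f e =
     (let e0 = eps0 nrm X L; \<epsilon> = eps_seq e0 e in
      packing_number nrm (near_opt X f e) (e / L) +
      (\<Sum>k = 1..num_layers e0 e.
         packing_number nrm (layer X f (\<epsilon> k) (\<epsilon> (k - 1))) (\<epsilon> k / L)))"

end

theory Submission imports Defs begin

text \<open>
  Write \<open>t(x) = f xstar - f x\<close> for the regret and \<open>d\<close> for the dimension. The sample complexity
  charges, for each threshold \<open>s\<close>, the packing number at scale \<open>s / L\<close> of a set on which \<open>t + \<epsilon>\<close> is
  comparable to \<open>s\<close>. A packing number at scale \<open>s / L\<close> is comparable to volume divided by
  \<open>(s / L) ^ d\<close>, and \<open>1 / (t + \<epsilon>) ^ d\<close> is comparable to \<open>1 / s ^ d\<close> on that set, so summing over the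
  levels gives the integral on both sides.

  Lower bound (\<open>integral_le_S_C\<close>): the near-optimal set and the layers partition \<open>X\<close>. A maximal
  packing is also a covering, so the volume of each piece is at most its packing number times the
  volume of a ball of radius \<open>s / L\<close> (\<open>vol_le_packing_number\<close>), while the integrand there is at most
  \<open>1 / s ^ d\<close>. Scaling of volumes cancels \<open>s ^ d\<close> and leaves the constant \<open>ball_vol nrm (1 / L)\<close>.

  Upper bound (\<open>S_C_le_integral\<close>): balls of radius \<open>s / (2 * L)\<close> around the points of a packing are
  disjoint, and each meets \<open>X\<close> in at least a \<open>\<gamma>\<close>-fraction of its volume
  (\<open>packing_number_mult_le_vol\<close>). The Lipschitz condition changes the regret by at most \<open>s / 2\<close> on such
  a ball, so the balls stay in an enlarged layer, where \<open>s / 2 < t \<le> 5 / 2 * s\<close>. The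
  enlarged layers are not disjoint any more, but since the levels halve, a point lies in at most four
  of them (\<open>card_enlarged_layers_le\<close>), and in at most five enlarged sets if the near-optimal
  one is included. The ratio of the radii \<open>s / (2 * L)\<close> and \<open>s / (128 * L)\<close> leaves more than
  enough room to absorb the factor \<open>5\<close>, because \<open>5 * (7 / 2) ^ d \<le> 64 ^ d\<close> for every \<open>d \<ge> 1\<close>; here
  \<open>7 / 2 * s\<close> bounds \<open>t + \<epsilon>\<close> on an enlarged set of level \<open>s\<close>.

  In both directions the comparison is first made pointwise, between the integrand and a step
  function built from the indicators of the pieces, and then integrated.
\<close>

section \<open>Volumes of balls of an arbitrary norm\<close>

lemma
  assumes "is_norm nrm"
  shows is_norm_nonneg: "nrm x \<ge> 0"
    and is_norm_eq_0_iff: "nrm x = 0 \<longleftrightarrow> x = 0"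
    and is_norm_scaleR: "nrm (a *\<^sub>R x) = \<bar>a\<bar> * nrm x"
    and is_norm_triangle: "nrm (x + y) \<le> nrm x + nrm y"
  using assms by (auto simp: is_norm_def)

lemma is_norm_minus_commute:
  assumes "is_norm nrm"
  shows "nrm (x - y) = nrm (y - x)"
  using is_norm_scaleR[OF assms, of "-1" "y - x"] by simp

lemma is_norm_triangle_sub:
  assumes "is_norm nrm"
  shows "nrm (x - z) \<le> nrm (x - y) + nrm (y - z)"
  using is_norm_triangle[OF assms, of "x - y" "y - z"] by simp

text \<open>A norm is convex, and a finite convex function on a finite-dimensional space is continuous.\<close>

lemma is_norm_continuous_on:
  fixes nrm :: "real ^ 'n \<Rightarrow> real"
  assumes "is_norm nrm"
  shows "continuous_on S nrm"
proof -
  have "convex_on UNIV nrm"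
  proof (intro convex_onI)
    fix t :: real and x y :: "real ^ 'n"
    assume "0 < t" "t < 1"
    then show "nrm ((1 - t) *\<^sub>R x + t *\<^sub>R y) \<le> (1 - t) * nrm x + t * nrm y"
      using is_norm_triangle[OF assms, of "(1 - t) *\<^sub>R x" "t *\<^sub>R y"]
      by (simp add: is_norm_scaleR[OF assms])
  qed auto
  then show ?thesis
    using convex_on_continuous[of UNIV nrm] continuous_on_subset by blast
qed

text \<open>
  One half of the equivalence of norms: \<open>c\<close> is the minimum of the norm on the Euclidean unit sphere,
  which is positive by compactness. It makes the balls of the norm bounded.
\<close>

lemma is_norm_ge_euclidean:
  fixes nrm :: "real ^ 'n \<Rightarrow> real"
  assumes "is_norm nrm"
  obtains c where "c > 0" "\<And>x. c * norm x \<le> nrm x"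
proof -
  have "compact (sphere (0 :: real ^ 'n) 1)" "sphere (0 :: real ^ 'n) 1 \<noteq> {}"
    by simp_all
  then obtain u where u: "u \<in> sphere 0 1" "\<And>y. y \<in> sphere 0 1 \<Longrightarrow> nrm u \<le> nrm y"
    using continuous_attains_inf[OF _ _ is_norm_continuous_on[OF assms]] by metis
  show thesis
  proof
    have "u \<noteq> 0" using u(1) by auto
    then show "nrm u > 0"
      using is_norm_nonneg[OF assms, of u] is_norm_eq_0_iff[OF assms, of u] by simp
    fix x :: "real ^ 'n"
    show "nrm u * norm x \<le> nrm x"
    proof (cases "x = 0")
      case True
      then show ?thesis using is_norm_nonneg[OF assms, of x] by simp
    next
      case False
      have "nrm u \<le> nrm ((1 / norm x) *\<^sub>R x)"
        by (rule u(2)) (use False in simp)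
      then show ?thesis
        using False by (simp add: is_norm_scaleR[OF assms] field_simps)
    qed
  qed
qed

lemma compact_nball:
  fixes nrm :: "real ^ 'n \<Rightarrow> real"
  assumes "is_norm nrm"
  shows "compact (nball nrm x r)"
proof -
  obtain c where c: "c > 0" "\<And>x. c * norm x \<le> nrm x"
    using is_norm_ge_euclidean[OF assms] by blast
  have "nball nrm x r \<subseteq> cball x (r / c)"
  proof
    fix y assume "y \<in> nball nrm x r"
    then have "c * norm (y - x) \<le> r"
      using c(2)[of "y - x"] by (simp add: nball_def)
    then show "y \<in> cball x (r / c)"
      using c(1) by (simp add: dist_norm norm_minus_commute field_simps)
  qed
  moreover have "closed (nball nrm x r)"
    unfolding nball_def
    by (intro closed_Collect_le continuous_intros
        continuous_on_compose2[OF is_norm_continuous_on[OF assms], of UNIV]) auto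
  ultimately show ?thesis
    using bounded_subset compact_eq_bounded_closed bounded_cball by blast
qed

lemma lmeasurable_nball:
  assumes "is_norm nrm"
  shows "nball nrm x r \<in> lmeasurable"
  by (intro lmeasurable_compact compact_nball assms)

lemma vol_nball_scaled:
  fixes nrm :: "real ^ 'n \<Rightarrow> real"
  assumes "is_norm nrm" and "t > 0"
  shows "vol (nball nrm x (t * r)) = t ^ CARD('n) * ball_vol nrm r"
proof -
  have "nball nrm x (t * r) = (\<lambda>y. t *\<^sub>R y + x) ` nball nrm 0 r"
  proof (intro equalityI subsetI)
    fix y assume y: "y \<in> nball nrm x (t * r)"
    have "nrm ((1 / t) *\<^sub>R (y - x)) \<le> r"
      using y \<open>t > 0\<close>
      by (simp only: is_norm_scaleR[OF assms(1)]) (simp add: nball_def field_simps)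
    then have "(1 / t) *\<^sub>R (y - x) \<in> nball nrm 0 r"
      by (simp add: nball_def)
    moreover have "y = t *\<^sub>R ((1 / t) *\<^sub>R (y - x)) + x"
      using \<open>t > 0\<close> by simp
    ultimately show "y \<in> (\<lambda>y. t *\<^sub>R y + x) ` nball nrm 0 r"
      by blast
  next
    fix y assume "y \<in> (\<lambda>y. t *\<^sub>R y + x) ` nball nrm 0 r"
    then show "y \<in> nball nrm x (t * r)"
      using \<open>t > 0\<close> by (auto simp: nball_def is_norm_scaleR[OF assms(1)])
  qed
  then show ?thesis
    using \<open>t > 0\<close> by (simp add: vol_def ball_vol_def measure_lebesgue_affine)
qed

lemma vol_nball:
  assumes "is_norm nrm"
  shows "vol (nball nrm x r) = ball_vol nrm r"
  using vol_nball_scaled[OF assms, of 1 x r] by simp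

lemma ball_vol_pos:
  fixes nrm :: "real ^ 'n \<Rightarrow> real"
  assumes "is_norm nrm" and "r > 0"
  shows "ball_vol nrm r > 0"
proof -
  have "open {y. nrm y < r}"
    by (intro open_Collect_less is_norm_continuous_on[OF assms(1)] continuous_intros)
  moreover have "0 \<in> {y. nrm y < r}"
    using assms is_norm_eq_0_iff[OF assms(1), of 0] by simp
  moreover have "{y. nrm y < r} \<subseteq> nball nrm 0 r"
    by (auto simp: nball_def)
  ultimately have "\<not> negligible (nball nrm 0 r)"
    using open_not_negligible negligible_subset by blast
  then have "measure lebesgue (nball nrm 0 r) \<noteq> 0"
    using lmeasurable_nball[OF assms(1)] negligible_iff_measure by blast
  then show ?thesis
    by (simp add: ball_vol_def vol_def zero_less_measure_iff)
qed

section \<open>Packing numbers\<close>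

text \<open>
  The volume comparison for packings: the balls of half the separation are pairwise disjoint, so
  their traces on \<open>X\<close> add up to at most the volume of any set that contains them. With \<open>X = UNIV\<close>
  it shows that packings of a bounded set have bounded size; with the domain of the
  objective function for \<open>X\<close> it carries the upper bound on the sample complexity.
\<close>

lemma card_packing_mult_le_vol:
  fixes nrm :: "real ^ 'n \<Rightarrow> real"
  assumes nrm: "is_norm nrm"
    and F: "finite F" "pairwise (\<lambda>x y. nrm (x - y) > r) F"
    and meas: "X \<in> sets lebesgue" "A \<in> lmeasurable"
    and sub: "\<And>x. x \<in> F \<Longrightarrow> nball nrm x (r / 2) \<inter> X \<subseteq> A"
    and w: "\<And>x. x \<in> F \<Longrightarrow> w \<le> vol (nball nrm x (r / 2) \<inter> X)"
  shows "real (card F) * w \<le> vol A"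
proof -
  have mb: "nball nrm x (r / 2) \<inter> X \<in> lmeasurable" for x
    using lmeasurable_nball[OF nrm] meas(1) by (rule fmeasurable_Int_fmeasurable)
  have "pairwise (\<lambda>x y. disjnt (nball nrm x (r / 2) \<inter> X) (nball nrm y (r / 2) \<inter> X)) F"
  proof (rule pairwise_mono[OF F(2)])
    fix x y assume xy: "nrm (x - y) > r"
    show "disjnt (nball nrm x (r / 2) \<inter> X) (nball nrm y (r / 2) \<inter> X)"
    proof (rule ccontr)
      assume "\<not> ?thesis"
      then obtain z where "nrm (z - x) \<le> r / 2" "nrm (z - y) \<le> r / 2"
        by (auto simp: disjnt_def nball_def)
      then show False
        using xy is_norm_triangle_sub[OF nrm, of x y z] is_norm_minus_commute[OF nrm, of x z]
        by simp
    qed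
  qed auto
  then have "vol (\<Union>x\<in>F. nball nrm x (r / 2) \<inter> X) = (\<Sum>x\<in>F. vol (nball nrm x (r / 2) \<inter> X))"
    unfolding vol_def by (intro measure_UNION' F(1) mb)
  moreover have "vol (\<Union>x\<in>F. nball nrm x (r / 2) \<inter> X) \<le> vol A"
    unfolding vol_def
  proof (rule measure_mono_fmeasurable)
    show "(\<Union>x\<in>F. nball nrm x (r / 2) \<inter> X) \<in> sets lebesgue"
      using mb F(1) by (intro sets.finite_UN) (auto dest: fmeasurableD)
  qed (use sub meas in auto)
  moreover have "(\<Sum>x\<in>F. vol (nball nrm x (r / 2) \<inter> X)) \<ge> real (card F) * w"
    using w by (rule sum_bounded_below)
  ultimately show ?thesis by simp
qed

lemma bounded_card_packing:
  fixes nrm :: "real ^ 'n \<Rightarrow> real"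
  assumes nrm: "is_norm nrm" and "bounded E" and "r > 0"
  obtains b :: nat where "\<And>F. finite F \<Longrightarrow> F \<subseteq> E \<Longrightarrow> pairwise (\<lambda>x y. nrm (x - y) > r) F \<Longrightarrow> card F \<le> b"
proof -
  \<comment> \<open>Passing to the closure makes this union a Minkowski sum of compact sets.\<close>
  have "bounded (\<Union>x\<in>closure E. nball nrm x (r / 2))"
  proof -
    have "compact ((\<lambda>(x, y). x + y) ` (closure E \<times> nball nrm 0 (r / 2)))"
      using \<open>bounded E\<close> compact_nball[OF nrm]
      by (intro compact_continuous_image compact_Times)
        (auto simp: compact_closure case_prod_unfold intro!: continuous_intros)
    moreover have "(\<Union>x\<in>closure E. nball nrm x (r / 2))
        \<subseteq> (\<lambda>(x, y). x + y) ` (closure E \<times> nball nrm 0 (r / 2))"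
    proof clarify
      fix x y assume "x \<in> closure E" "y \<in> nball nrm x (r / 2)"
      then show "y \<in> (\<lambda>(x, y). x + y) ` (closure E \<times> nball nrm 0 (r / 2))"
        by (intro image_eqI[of _ _ "(x, y - x)"]) (auto simp: nball_def)
    qed
    ultimately show ?thesis
      using compact_imp_bounded bounded_subset by blast
  qed
  from bounded_subset_ballD[OF this, of 0]
  obtain R where R: "(\<Union>x\<in>closure E. nball nrm x (r / 2)) \<subseteq> ball 0 R"
    by (elim exE conjE)
  define w where "w = ball_vol nrm (r / 2)"
  have w: "w > 0"
    unfolding w_def using \<open>r > 0\<close> by (intro ball_vol_pos nrm) simp
  show thesis
  proof
    fix F assume F: "finite F" "F \<subseteq> E" "pairwise (\<lambda>x y. nrm (x - y) > r) F"
    have "real (card F) * w \<le> vol (ball (0 :: real ^ 'n) R)"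
    proof (rule card_packing_mult_le_vol[OF nrm F(1,3), of UNIV])
      show "nball nrm x (r / 2) \<inter> UNIV \<subseteq> ball 0 R" if "x \<in> F" for x
        using R F(2) that closure_subset[of E] by blast
      show "w \<le> vol (nball nrm x (r / 2) \<inter> UNIV)" for x
        by (simp add: w_def vol_nball[OF nrm])
    qed auto
    then have "real (card F) \<le> vol (ball (0 :: real ^ 'n) R) / w"
      using w by (simp add: field_simps)
    then show "card F \<le> nat \<lfloor>vol (ball (0 :: real ^ 'n) R) / w\<rfloor>"
      by (simp add: le_nat_floor)
  qed
qed

text \<open>
  Replacing enumerated packings by finite sets of points lets the supremum be attained at an actual
  set. The empty set is a packing, so the case \<open>E = {}\<close> is covered as well.
\<close>

lemma packing_number_eq_Max:
  fixes nrm :: "real ^ 'n \<Rightarrow> real"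
  assumes nrm: "is_norm nrm" and "bounded E" and "r > 0"
  defines "P \<equiv> {F. finite F \<and> F \<subseteq> E \<and> pairwise (\<lambda>x y. nrm (x - y) > r) F}"
  shows "packing_number nrm E r = Max (card ` P)" and "finite (card ` P)" and "P \<noteq> {}"
proof -
  obtain b where b: "\<And>F. finite F \<Longrightarrow> F \<subseteq> E \<Longrightarrow> pairwise (\<lambda>x y. nrm (x - y) > r) F \<Longrightarrow> card F \<le> b"
    using bounded_card_packing[OF assms(1-3)] by blast
  have "card ` P \<subseteq> {..b}"
    using b by (auto simp: P_def)
  then show fin: "finite (card ` P)"
    using finite_subset by blast
  have empty: "{} \<in> P" by (simp add: P_def)
  then show "P \<noteq> {}" by blast
  show "packing_number nrm E r = Max (card ` P)"
  proof (cases "E = {}")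
    case True
    then have "P = {{}}" by (auto simp: P_def)
    with True show ?thesis by (simp add: packing_number_def)
  next
    case False
    let ?Q = "\<lambda>k (x :: nat \<Rightarrow> real ^ 'n). (\<forall>i\<in>{1..k}. x i \<in> E) \<and>
        (\<forall>i\<in>{1..k}. \<forall>j\<in>{1..k}. i \<noteq> j \<longrightarrow> nrm (x i - x j) > r)"
    have eq: "{k. k \<ge> 1 \<and> (\<exists>x. ?Q k x)} = card ` P - {0}"
    proof (intro equalityI subsetI)
      fix k assume "k \<in> {k. k \<ge> 1 \<and> (\<exists>x. ?Q k x)}"
      then obtain x where k: "k \<ge> 1" and x: "?Q k x" by blast
      have "inj_on x {1..k}"
      proof (rule inj_onI, rule ccontr)
        fix i j assume "i \<in> {1..k}" "j \<in> {1..k}" "x i = x j" "i \<noteq> j"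
        then have "nrm (x i - x i) > r" using x by metis
        then show False
          using \<open>r > 0\<close> is_norm_eq_0_iff[OF nrm, of 0] by simp
      qed
      then have "card (x ` {1..k}) = k"
        by (simp add: card_image)
      moreover have "x ` {1..k} \<in> P"
        using x by (force simp: P_def pairwise_def)
      ultimately show "k \<in> card ` P - {0}"
        using k by force
    next
      fix k assume "k \<in> card ` P - {0}"
      then obtain F where F: "F \<in> P" "k = card F" "k \<ge> 1" by force
      then obtain x where x: "bij_betw x {1..k} F"
        using ex_bij_betw_nat_finite_1[of F] by (auto simp: P_def)
      have sub: "F \<subseteq> E" and sep: "pairwise (\<lambda>x y. nrm (x - y) > r) F"
        using F(1) by (simp_all add: P_def)
      have mem: "x i \<in> F" if "i \<in> {1..k}" for i
        using bij_betwE[OF x] that by blast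
      have "nrm (x i - x j) > r" if "i \<in> {1..k}" "j \<in> {1..k}" "i \<noteq> j" for i j
        using pairwiseD[OF sep mem[OF that(1)] mem[OF that(2)]]
          inj_onD[OF bij_betw_imp_inj_on[OF x] _ that(1,2)] that(3) by blast
      then have "?Q k x"
        using mem sub by blast
      then show "k \<in> {k. k \<ge> 1 \<and> (\<exists>x. ?Q k x)}"
        using F(3) by blast
    qed
    obtain e where "e \<in> E" using False by blast
    then have "{e} \<in> P" by (simp add: P_def)
    then have one: "1 \<in> card ` P"
      by (intro image_eqI[of _ _ "{e}"]) auto
    then have ne: "card ` P - {0} \<noteq> {}" by auto
    have "Max (card ` P) \<ge> 1"
      using fin one by simp
    then have "Max (card ` P) \<in> card ` P - {0}"
      using Max_in[OF fin] one by fastforce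
    then have "Max (card ` P - {0}) = Max (card ` P)"
      using fin by (intro Max_eqI) auto
    then show ?thesis
      using False ne eq by (simp add: packing_number_def Sup_nat_def)
  qed
qed

lemma packing_number_attained:
  fixes nrm :: "real ^ 'n \<Rightarrow> real"
  assumes "is_norm nrm" and "bounded E" and "r > 0"
  obtains F where "finite F" "F \<subseteq> E" "pairwise (\<lambda>x y. nrm (x - y) > r) F"
    "card F = packing_number nrm E r"
proof -
  let ?P = "{F. finite F \<and> F \<subseteq> E \<and> pairwise (\<lambda>x y. nrm (x - y) > r) F}"
  have "card ` ?P \<noteq> {}"
    using packing_number_eq_Max(3)[OF assms] by (rule contrapos_nn) (rule image_is_empty[THEN iffD1])
  from Max_in[OF packing_number_eq_Max(2)[OF assms] this]
  have "packing_number nrm E r \<in> card ` ?P"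
    unfolding packing_number_eq_Max(1)[OF assms] .
  then obtain F where "F \<in> ?P" "packing_number nrm E r = card F"
    by (rule imageE)
  then show thesis using that[of F] by simp
qed

lemma card_le_packing_number:
  fixes nrm :: "real ^ 'n \<Rightarrow> real"
  assumes "is_norm nrm" and "bounded E" and "r > 0"
    and "finite F" "F \<subseteq> E" "pairwise (\<lambda>x y. nrm (x - y) > r) F"
  shows "card F \<le> packing_number nrm E r"
  unfolding packing_number_eq_Max(1)[OF assms(1-3)]
  by (intro Max_ge packing_number_eq_Max(2)[OF assms(1-3)] imageI CollectI conjI assms(4-6))

text \<open>A packing of maximal size covers: a point outside all the balls could be added to it.\<close>

lemma vol_le_packing_number:
  fixes nrm :: "real ^ 'n \<Rightarrow> real"
  assumes nrm: "is_norm nrm" and E: "bounded E" "E \<in> sets lebesgue" and "r > 0"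
  shows "vol E \<le> real (packing_number nrm E r) * ball_vol nrm r"
proof -
  obtain F where F: "finite F" "F \<subseteq> E" "pairwise (\<lambda>x y. nrm (x - y) > r) F"
    "card F = packing_number nrm E r"
    using packing_number_attained[OF nrm E(1) \<open>r > 0\<close>] by blast
  have cover: "E \<subseteq> (\<Union>x\<in>F. nball nrm x r)"
  proof (rule ccontr)
    assume "\<not> ?thesis"
    then obtain y where y: "y \<in> E" "\<And>x. x \<in> F \<Longrightarrow> nrm (y - x) > r"
      by (force simp: nball_def)
    have "y \<notin> F"
      using y(2)[of y] \<open>r > 0\<close> is_norm_eq_0_iff[OF nrm, of 0] by auto
    have "pairwise (\<lambda>x y. nrm (x - y) > r) (insert y F)"
      using F(3) y(2) is_norm_minus_commute[OF nrm] by (auto simp: pairwise_insert)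
    then have "card (insert y F) \<le> packing_number nrm E r"
      using F y by (intro card_le_packing_number[OF nrm E(1) \<open>r > 0\<close>]) auto
    then show False
      using F \<open>y \<notin> F\<close> by simp
  qed
  have "vol E \<le> vol (\<Union>x\<in>F. nball nrm x r)"
    unfolding vol_def using E(2) cover F(1) lmeasurable_nball[OF nrm]
    by (intro measure_mono_fmeasurable fmeasurable.finite_UN) auto
  also have "\<dots> \<le> (\<Sum>x\<in>F. vol (nball nrm x r))"
    unfolding vol_def using F(1) lmeasurable_nball[OF nrm]
    by (intro measure_UNION_le) (auto dest: fmeasurableD)
  also have "\<dots> = real (packing_number nrm E r) * ball_vol nrm r"
    using F(4) by (simp add: vol_nball[OF nrm])
  finally show ?thesis .
qed

lemma packing_number_mult_le_vol:
  fixes nrm :: "real ^ 'n \<Rightarrow> real"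
  assumes nrm: "is_norm nrm" and E: "bounded E" and "r > 0"
    and meas: "X \<in> sets lebesgue" "A \<in> lmeasurable"
    and sub: "\<And>x. x \<in> E \<Longrightarrow> nball nrm x (r / 2) \<inter> X \<subseteq> A"
    and w: "\<And>x. x \<in> E \<Longrightarrow> w \<le> vol (nball nrm x (r / 2) \<inter> X)"
  shows "real (packing_number nrm E r) * w \<le> vol A"
proof -
  obtain F where F: "finite F" "F \<subseteq> E" "pairwise (\<lambda>x y. nrm (x - y) > r) F"
    "card F = packing_number nrm E r"
    using packing_number_attained[OF nrm E(1) \<open>r > 0\<close>] by blast
  then show ?thesis
    using card_packing_mult_le_vol[OF nrm F(1,3) meas, of w] sub w by auto
qed

section \<open>Maxima and Lipschitz constants\<close>

lemma max_on_eqI: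
  assumes "a \<in> A" and "\<And>x. x \<in> A \<Longrightarrow> g x \<le> g a"
  shows "max_on g A = g a"
  unfolding max_on_def using assms by (intro Greatest_equality) auto

text \<open>
  \<open>Lip\<close> is a least element, so it has to be shown that the infimum of all Lipschitz constants is
  itself one; the inequality for each pair of points survives passing to the infimum.
\<close>

lemma lip_class_imp_le:
  assumes nrm: "is_norm nrm" and f: "f \<in> lip_class nrm X L" and "x \<in> X" "y \<in> X"
  shows "\<bar>f x - f y\<bar> \<le> L * nrm (x - y)"
proof -
  define S where "S = {K. lipschitz_bound nrm X f K}"
  have ne: "S \<noteq> {}" and lt: "Lip nrm X f < L"
    using f by (auto simp: lip_class_def S_def)
  have bdd: "bdd_below S"
    by (rule bdd_belowI[of _ 0]) (auto simp: S_def lipschitz_bound_def)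
  have "lipschitz_bound nrm X f (Inf S)"
    unfolding lipschitz_bound_def
  proof (intro conjI ballI)
    show "0 \<le> Inf S"
      using ne by (intro cInf_greatest) (auto simp: S_def lipschitz_bound_def)
    fix x y assume xy: "x \<in> X" "y \<in> X"
    show "\<bar>f x - f y\<bar> \<le> Inf S * nrm (x - y)"
    proof (cases "x = y")
      case True
      then show ?thesis using is_norm_eq_0_iff[OF nrm, of 0] by simp
    next
      case False
      then have pos: "nrm (x - y) > 0"
        using is_norm_nonneg[OF nrm, of "x - y"] is_norm_eq_0_iff[OF nrm, of "x - y"] by simp
      have "\<bar>f x - f y\<bar> / nrm (x - y) \<le> Inf S"
        using ne
      proof (rule cInf_greatest)
        fix K assume "K \<in> S"
        then show "\<bar>f x - f y\<bar> / nrm (x - y) \<le> K"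
          using xy pos by (simp add: S_def lipschitz_bound_def field_simps)
      qed
      then show ?thesis using pos by (simp add: field_simps)
    qed
  qed
  moreover from this have "Lip nrm X f = Inf S"
    unfolding Lip_def by (intro Least_equality) (auto simp: S_def intro!: cInf_lower bdd[unfolded S_def])
  ultimately have "\<bar>f x - f y\<bar> \<le> Lip nrm X f * nrm (x - y)"
    using \<open>x \<in> X\<close> \<open>y \<in> X\<close> by (simp add: lipschitz_bound_def)
  also have "\<dots> \<le> L * nrm (x - y)"
    using lt is_norm_nonneg[OF nrm] by (intro mult_right_mono) auto
  finally show ?thesis .
qed

lemma mult_nrm_le_eps0:
  fixes nrm :: "real ^ 'n \<Rightarrow> real"
  assumes nrm: "is_norm nrm" and "compact X" and "L > 0" and "x \<in> X" "y \<in> X"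
  shows "L * nrm (x - y) \<le> eps0 nrm X L"
proof -
  let ?h = "\<lambda>(x, y). nrm (x - y)"
  have "continuous_on (X \<times> X) ?h"
    unfolding case_prod_unfold
    by (intro continuous_on_compose2[OF is_norm_continuous_on[OF nrm, of UNIV]] continuous_intros) auto
  moreover have "compact (X \<times> X)" "X \<times> X \<noteq> {}"
    using assms by (auto intro: compact_Times)
  ultimately obtain p where "p \<in> X \<times> X" "\<And>q. q \<in> X \<times> X \<Longrightarrow> ?h q \<le> ?h p"
    using continuous_attains_sup by metis
  then have "?h (x, y) \<le> max_on ?h (X \<times> X)"
    using max_on_eqI[of p "X \<times> X" ?h] assms by force
  then show ?thesis
    using \<open>L > 0\<close> by (simp add: eps0_def)
qed

lemma continuous_on_lipschitz_is_norm:
  fixes nrm :: "real ^ 'n \<Rightarrow> real"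
  assumes nrm: "is_norm nrm"
    and lip: "\<And>x y. x \<in> X \<Longrightarrow> y \<in> X \<Longrightarrow> \<bar>f x - f y\<bar> \<le> L * nrm (x - y)"
  shows "continuous_on X f"
  unfolding continuous_on_def
proof
  fix x assume x: "x \<in> X"
  have "((\<lambda>y. L * nrm (y - x)) \<longlongrightarrow> L * nrm (x - x)) (at x within X)"
    by (intro tendsto_intros continuous_on_tendsto_compose[OF is_norm_continuous_on[OF nrm, of UNIV]]) auto
  then have "((\<lambda>y. L * nrm (y - x)) \<longlongrightarrow> 0) (at x within X)"
    using is_norm_eq_0_iff[OF nrm, of 0] by simp
  moreover have "\<forall>\<^sub>F y in at x within X. norm (f y - f x) \<le> L * nrm (y - x)"
    using lip x by (auto simp: eventually_at_filter)
  ultimately have "((\<lambda>y. f y - f x) \<longlongrightarrow> 0) (at x within X)"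
    by (rule Lim_null_comparison[rotated])
  then show "(f \<longlongrightarrow> f x) (at x within X)"
    using LIM_zero_iff by blast
qed

section \<open>The layer thresholds\<close>

text \<open>
  The sequence halves at every step except the last, which goes down to \<open>e\<close> and
  may fall short of a halving. Hence \<open>j - k\<close> steps give a factor of at least \<open>2 ^ (j - k - 1)\<close> only.
\<close>

context
  fixes e0 e :: real
  assumes e: "0 < e" "e \<le> e0"
begin

lemma less_eps0_div_power:
  assumes "k < num_layers e0 e"
  shows "e < e0 / 2 ^ k"
proof -
  have "real k < log 2 (e0 / e)"
    using assms unfolding num_layers_def by linarith
  then have "2 powr real k < e0 / e"
    using e by (simp add: less_log_iff)
  then show ?thesis
    using e by (simp add: powr_realpow field_simps)
qed

lemma eps0_le_mult_power: "e0 \<le> e * 2 ^ num_layers e0 e"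
proof -
  have "log 2 (e0 / e) \<le> real (num_layers e0 e)"
    unfolding num_layers_def by linarith
  then have "e0 / e \<le> 2 powr real (num_layers e0 e)"
    using e by (simp add: log_le_iff)
  then show ?thesis
    using e by (simp add: powr_realpow field_simps)
qed

text \<open>If there are no layers, the sequence starts at \<open>e\<close>, which then equals \<open>e0\<close>.\<close>

lemma eps_seq_0: "eps_seq e0 e 0 = e0"
  using eps0_le_mult_power e by (auto simp: eps_seq_def)

lemma eps_seq_ge: "e \<le> eps_seq e0 e k"
  using less_eps0_div_power[of k] by (auto simp: eps_seq_def)

lemma eps_seq_last: "eps_seq e0 e (num_layers e0 e) = e"
  by (simp add: eps_seq_def)

lemma eps_seq_le:
  assumes "k \<ge> 1" "k \<le> num_layers e0 e"
  shows "eps_seq e0 e k \<le> e0 / 2 ^ (k - 1)"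
proof (cases "k = num_layers e0 e")
  case True
  then show ?thesis
    using less_eps0_div_power[of "k - 1"] assms by (simp add: eps_seq_def)
next
  case False
  have "e0 / 2 ^ k \<le> e0 / 2 ^ (k - 1)"
    using e by (intro divide_left_mono power_increasing) auto
  then show ?thesis using False assms by (simp add: eps_seq_def)
qed

lemma eps_seq_le_eps0: "eps_seq e0 e k \<le> e0"
proof -
  have "e0 / 2 ^ k \<le> e0 / 1"
    using e by (intro divide_left_mono) auto
  then show ?thesis using e by (simp add: eps_seq_def)
qed

lemma eps_seq_pred_le:
  assumes "k \<ge> 1" "k \<le> num_layers e0 e"
  shows "eps_seq e0 e (k - 1) \<le> 2 * eps_seq e0 e k"
proof -
  obtain j where j: "k = Suc j" using assms by (cases k) auto
  show ?thesis
  proof (cases "k = num_layers e0 e")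
    case True
    then show ?thesis
      using eps0_le_mult_power j
      by (simp add: eps_seq_def field_simps flip: True power_Suc)
  next
    case False
    then show ?thesis using assms j by (simp add: eps_seq_def)
  qed
qed

lemma eps_seq_gap:
  assumes "k + 4 \<le> j" "j \<le> num_layers e0 e"
  shows "eps_seq e0 e j \<le> eps_seq e0 e k / 8"
proof -
  have "eps_seq e0 e j \<le> e0 / 2 ^ (j - 1)"
    using assms by (intro eps_seq_le) auto
  also have "\<dots> \<le> e0 / 2 ^ (k + 3)"
    using e assms by (intro divide_left_mono power_increasing) auto
  also have "\<dots> = eps_seq e0 e k / 8"
    using assms by (simp add: eps_seq_def power_add)
  finally show ?thesis .
qed

text \<open>
  Two levels whose windows \<open>(s / 2, 5 / 2 * s]\<close> share a point differ by a factor less than \<open>5\<close>, whereas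
  four steps of the sequence give a factor of at least \<open>8\<close>.
\<close>

lemma card_enlarged_layers_le:
  "card {k \<in> {1..num_layers e0 e}. eps_seq e0 e k / 2 < t \<and> t \<le> 5 / 2 * eps_seq e0 e k} \<le> 4"
  (is "card ?K \<le> 4")
proof (cases "?K = {}")
  case True
  then show ?thesis by (metis card.empty zero_le)
next
  case False
  have fin: "finite ?K" by simp
  define k where "k = Min ?K"
  have k: "k \<in> ?K"
    unfolding k_def using fin False by (rule Min_in)
  have "?K \<subseteq> {k..<k + 4}"
  proof
    fix j assume j: "j \<in> ?K"
    have "\<not> k + 4 \<le> j"
    proof
      assume "k + 4 \<le> j"
      then have "eps_seq e0 e j \<le> eps_seq e0 e k / 8"
        using j by (intro eps_seq_gap) auto
      then show False
        using j k eps_seq_ge[of k] e by auto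
    qed
    moreover have "k \<le> j"
      unfolding k_def using fin j by (rule Min_le)
    ultimately show "j \<in> {k..<k + 4}" by simp
  qed
  then have "card ?K \<le> card {k..<k + 4}"
    by (intro card_mono) auto
  then show ?thesis by simp
qed

end

lemma ex_step_crossing:
  fixes s :: "nat \<Rightarrow> real"
  assumes "s n < t" "t \<le> s 0"
  shows "\<exists>k\<in>{1..n}. s k < t \<and> t \<le> s (k - 1)"
  using assms
proof (induction n)
  case (Suc n)
  show ?case
  proof (cases "s n < t")
    case True
    then show ?thesis using Suc by force
  next
    case False
    then show ?thesis using Suc by (intro bexI[of _ "Suc n"]) auto
  qed
qed simp

section \<open>The sample complexity and the integral\<close>

lemma near_opt_subset: "near_opt X f b \<subseteq> X"
  and layer_subset: "layer X f a b \<subseteq> X"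
  by (auto simp: near_opt_def layer_def)

lemma layer_eq_Diff: "layer X f a b = near_opt X f b - near_opt X f a"
  by (auto simp: layer_def near_opt_def)

lemma compact_near_opt:
  fixes f :: "real ^ 'n \<Rightarrow> real"
  assumes "compact X" and "continuous_on X f"
  shows "compact (near_opt X f b)"
proof -
  have "near_opt X f b = X \<inter> f -` {max_on f X - b..}"
    by (auto simp: near_opt_def)
  moreover have "closed (X \<inter> f -` {max_on f X - b..})"
    using assms compact_imp_closed by (intro continuous_closed_preimage) auto
  ultimately show ?thesis
    using assms(1) compact_Int_closed[of X "near_opt X f b"]
    by (metis inf.absorb_iff2 inf_le1)
qed

context
  fixes X :: "(real ^ 'n) set"
    and nrm :: "real ^ 'n \<Rightarrow> real"
    and f :: "real ^ 'n \<Rightarrow> real"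
    and xstar :: "real ^ 'n"
    and L :: real
  assumes X: "compact X" and nrm: "is_norm nrm" and L: "L > 0"
    and lip: "\<And>x y. x \<in> X \<Longrightarrow> y \<in> X \<Longrightarrow> \<bar>f x - f y\<bar> \<le> L * nrm (x - y)"
    and xstar: "xstar \<in> X" "\<And>x. x \<in> X \<Longrightarrow> f x \<le> f xstar"
begin

lemma max_on_eq: "max_on f X = f xstar"
  using xstar by (rule max_on_eqI)

lemma lmeasurable_near_opt: "near_opt X f b \<in> lmeasurable"
  using X continuous_on_lipschitz_is_norm[OF nrm lip]
  by (intro lmeasurable_compact compact_near_opt)

lemma lmeasurable_layer: "layer X f a b \<in> lmeasurable"
  unfolding layer_eq_Diff by (intro fmeasurable.Diff lmeasurable_near_opt)

lemma bounded_pieces: "bounded (near_opt X f b)" "bounded (layer X f a b)"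
  by (rule bounded_subset[OF compact_imp_bounded[OF X]], rule near_opt_subset layer_subset)+

lemma set_integrable_regret:
  assumes "e > 0"
  shows "set_integrable lebesgue X (\<lambda>x. 1 / (f xstar - f x + e) ^ CARD('n))"
proof -
  have "f xstar - f x + e \<noteq> 0" if "x \<in> X" for x
    using xstar(2)[OF that] assms by simp
  then have "continuous_on X (\<lambda>x. 1 / (f xstar - f x + e) ^ CARD('n))"
    by (intro continuous_intros continuous_on_lipschitz_is_norm[OF nrm lip]) auto
  then have "integrable lborel (\<lambda>x. indicator X x *\<^sub>R (1 / (f xstar - f x + e) ^ CARD('n)))"
    by (rule borel_integrable_compact[OF X])
  then show ?thesis
    unfolding set_integrable_def
    using integrable_completion[of _ lborel] borel_measurable_integrable by blast
qed

lemma integrable_step: "integrable lebesgue (\<lambda>x. indicator (near_opt X f b) x * c :: real)"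
    "integrable lebesgue (\<lambda>x. indicator (layer X f a b) x * c :: real)"
  using lmeasurable_near_opt[of b] lmeasurable_layer[of a b] by (auto simp: fmeasurable_def)

lemma
  shows integrable_steps: "integrable lebesgue (\<lambda>x. indicator (near_opt X f b) x * c
        + (\<Sum>k\<in>K. indicator (layer X f (u k) (v k)) x * w k))" (is "integrable _ (\<lambda>x. ?g x + ?h x)")
    and integral_steps: "(\<integral>x. indicator (near_opt X f b) x * c
        + (\<Sum>k\<in>K. indicator (layer X f (u k) (v k)) x * w k) \<partial>lebesgue)
    = vol (near_opt X f b) * c + (\<Sum>k\<in>K. vol (layer X f (u k) (v k)) * w k)"
proof -
  have h: "integrable lebesgue ?h"
    by (intro Bochner_Integration.integrable_sum integrable_step)
  then show "integrable lebesgue (\<lambda>x. ?g x + ?h x)"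
    by (intro Bochner_Integration.integrable_add integrable_step)
  have "(\<integral>x. ?g x + ?h x \<partial>lebesgue) = (\<integral>x. ?g x \<partial>lebesgue) + (\<integral>x. ?h x \<partial>lebesgue)"
    by (rule Bochner_Integration.integral_add[OF integrable_step(1) h])
  also have "(\<integral>x. ?h x \<partial>lebesgue)
      = (\<Sum>k\<in>K. \<integral>x. indicator (layer X f (u k) (v k)) x * w k \<partial>lebesgue)"
    by (intro Bochner_Integration.integral_sum integrable_step)
  finally show "(\<integral>x. ?g x + ?h x \<partial>lebesgue)
      = vol (near_opt X f b) * c + (\<Sum>k\<in>K. vol (layer X f (u k) (v k)) * w k)"
    by (simp add: vol_def)
qed

text \<open>
  The volume comparison on one level \<open>s\<close>, where \<open>A\<close> stands for the enlarged piece. The factor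
  \<open>1 / 5\<close> pays for the overlaps of the enlarged pieces when the levels are summed: the balls of the packing
  have \<open>64 * s\<close> times the radius \<open>1 / (128 * L)\<close>, and \<open>64\<close> exceeds \<open>7 / 2\<close> more than fivefold.
\<close>

lemma packing_mult_le_vol_enlarged:
  assumes "s > 0" "s / (2 * L) < r0" "0 < \<gamma>"
    and dens: "\<And>x r. x \<in> X \<Longrightarrow> 0 < r \<Longrightarrow> r < r0 \<Longrightarrow>
           vol (nball nrm x r \<inter> X) \<ge> \<gamma> * ball_vol nrm r"
    and E: "E \<subseteq> X" "A \<in> lmeasurable"
    and EA: "\<And>x y. x \<in> E \<Longrightarrow> y \<in> X \<Longrightarrow> \<bar>f x - f y\<bar> \<le> s / 2 \<Longrightarrow> y \<in> A"
  shows "real (packing_number nrm E (s / L)) * (\<gamma> * ball_vol nrm (1 / (128 * L)))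
    \<le> 1 / 5 * (vol A * (1 / (7 / 2 * s) ^ CARD('n)))"
proof -
  let ?d = "CARD('n)" and ?N = "real (packing_number nrm E (s / L))"
  let ?W = "\<gamma> * ball_vol nrm (1 / (128 * L))"
  have "?N * (\<gamma> * ball_vol nrm (s / L / 2)) \<le> vol A"
  proof (rule packing_number_mult_le_vol[OF nrm, of _ _ X])
    show "bounded E"
      by (rule bounded_subset[OF compact_imp_bounded[OF X] E(1)])
    show "X \<in> sets lebesgue"
      by (rule fmeasurableD[OF lmeasurable_compact[OF X]])
    fix x assume x: "x \<in> E"
    show "nball nrm x (s / L / 2) \<inter> X \<subseteq> A"
    proof
      fix y assume y: "y \<in> nball nrm x (s / L / 2) \<inter> X"
      then have "L * nrm (x - y) \<le> s / 2"
        using L is_norm_minus_commute[OF nrm, of x y] by (simp add: nball_def field_simps)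
      then show "y \<in> A"
        using EA[OF x, of y] lip[of x y] x y E(1) by force
    qed
    show "\<gamma> * ball_vol nrm (s / L / 2) \<le> vol (nball nrm x (s / L / 2) \<inter> X)"
      using assms(1,2) L x E(1) by (intro dens) (auto simp: mult.commute)
  qed (use assms L in auto)
  moreover have "ball_vol nrm (s / L / 2) = (64 * s) ^ ?d * ball_vol nrm (1 / (128 * L))"
    using vol_nball_scaled[OF nrm, of "64 * s" 0 "1 / (128 * L)"] \<open>s > 0\<close>
    by (simp add: vol_nball[OF nrm] field_simps)
  ultimately have main: "?N * ?W * (64 * s) ^ ?d \<le> vol A"
    by (simp add: mult_ac)
  have "5 * (7 / 2 * s) ^ ?d \<le> (64 * s) ^ ?d"
  proof -
    have "(7 / 128 :: real) ^ ?d \<le> (7 / 128) ^ 1"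
      by (intro power_decreasing) auto
    moreover have "(7 / 2 * s) ^ ?d = (7 / 128) ^ ?d * (64 * s) ^ ?d"
      unfolding power_mult_distrib[symmetric] by simp
    ultimately show ?thesis
      using mult_right_mono[of "5 * (7 / 128) ^ ?d" 1 "(64 * s) ^ ?d"] \<open>s > 0\<close> by simp
  qed
  moreover have "0 \<le> ?N * ?W"
    using ball_vol_pos[OF nrm, of "1 / (128 * L)"] L \<open>\<gamma> > 0\<close> by simp
  ultimately have "?N * ?W * (5 * (7 / 2 * s) ^ ?d) \<le> vol A"
    using main by (meson mult_left_mono order_trans)
  then show ?thesis
    using \<open>s > 0\<close> by (simp add: field_simps)
qed

lemma vol_mult_le_packing:
  assumes "s > 0" "bounded E" "E \<in> lmeasurable"
  shows "vol E * (1 / s ^ CARD('n)) \<le> real (packing_number nrm E (s / L)) * ball_vol nrm (1 / L)"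
proof -
  have "vol E \<le> real (packing_number nrm E (s / L)) * ball_vol nrm (s / L)"
    using assms L by (intro vol_le_packing_number nrm) auto
  moreover have "ball_vol nrm (s / L) = s ^ CARD('n) * ball_vol nrm (1 / L)"
    using vol_nball_scaled[OF nrm, of s 0 "1 / L"] \<open>s > 0\<close> by (simp add: vol_nball[OF nrm])
  ultimately show ?thesis
    using \<open>s > 0\<close> by (simp add: field_simps)
qed

text \<open>
  Every point of \<open>X\<close> lies in one of the pieces, because the Lipschitz condition bounds the
  regret by the largest threshold; on that piece the integrand is dominated by the step function.
\<close>

lemma integral_le_S_C:
  assumes e: "0 < e" "e \<le> eps0 nrm X L"
  shows "(LINT x:X|lebesgue. 1 / (f xstar - f x + e) ^ CARD('n))
    \<le> real (S_C nrm X L f e) * ball_vol nrm (1 / L)"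
proof -
  define M where "M = num_layers (eps0 nrm X L) e"
  define s where "s = eps_seq (eps0 nrm X L) e"
  let ?d = "CARD('n)"
  have s_pos: "s k > 0" for k
    using eps_seq_ge[OF e, of k] e(1) by (simp add: s_def)
  have pointwise: "indicator X x *\<^sub>R (1 / (f xstar - f x + e) ^ ?d)
    \<le> indicator (near_opt X f e) x * (1 / e ^ ?d)
        + (\<Sum>k = 1..M. indicator (layer X f (s k) (s (k - 1))) x * (1 / s k ^ ?d))"
    (is "?l \<le> ?a + sum ?b _") for x
  proof (cases "x \<in> X")
    case True
    have nonneg: "?b k \<ge> 0" for k
      using s_pos[of k] by simp
    have t0: "f xstar - f x \<ge> 0"
      using xstar(2)[OF True] by simp
    show ?thesis
    proof (cases "f xstar - f x \<le> e")
      case close: True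
      have "?l \<le> ?a"
        using True close t0 e
        by (auto simp: near_opt_def max_on_eq intro!: divide_left_mono power_mono)
      moreover have "sum ?b {1..M} \<ge> 0" using nonneg by (rule sum_nonneg)
      ultimately show ?thesis by simp
    next
      case False
      have "f xstar - f x \<le> eps0 nrm X L"
        using lip[OF xstar(1) True] mult_nrm_le_eps0[OF nrm X L xstar(1) True] by linarith
      then obtain k where k: "k \<in> {1..M}" "s k < f xstar - f x" "f xstar - f x \<le> s (k - 1)"
        using ex_step_crossing[of s M "f xstar - f x"] False eps_seq_last[OF e] eps_seq_0[OF e]
        by (auto simp: s_def M_def)
      have "?l \<le> ?b k"
        using True k s_pos[of k] e(1)
        by (auto simp: layer_def max_on_eq intro!: divide_left_mono power_mono)
      also have "\<dots> \<le> sum ?b {1..M}"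
        using k(1) nonneg by (intro member_le_sum) auto
      finally have "?l \<le> sum ?b {1..M}" .
      moreover have "?a \<ge> 0" using e by simp
      ultimately show ?thesis by linarith
    qed
  qed (auto simp: near_opt_def layer_def)
  have "(LINT x:X|lebesgue. 1 / (f xstar - f x + e) ^ ?d)
    \<le> vol (near_opt X f e) * (1 / e ^ ?d)
      + (\<Sum>k = 1..M. vol (layer X f (s k) (s (k - 1))) * (1 / s k ^ ?d))"
    unfolding set_lebesgue_integral_def integral_steps[symmetric]
    by (intro integral_mono pointwise integrable_steps
        set_integrable_regret[OF e(1), unfolded set_integrable_def])
  also have "\<dots> \<le> real (packing_number nrm (near_opt X f e) (e / L)) * ball_vol nrm (1 / L)
      + (\<Sum>k = 1..M. real (packing_number nrm (layer X f (s k) (s (k - 1))) (s k / L)) * ball_vol nrm (1 / L))"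
    by (intro add_mono sum_mono vol_mult_le_packing s_pos e bounded_pieces
        lmeasurable_near_opt lmeasurable_layer)
  also have "\<dots> = real (S_C nrm X L f e) * ball_vol nrm (1 / L)"
    by (simp add: S_C_def Let_def s_def M_def distrib_right sum_distrib_right)
  finally show ?thesis .
qed

text \<open>
  The step function over the enlarged pieces is dominated by five times the integrand, one share for
  each enlarged piece that may contain the point.
\<close>

lemma S_C_le_integral:
  assumes e: "0 < e" "e \<le> eps0 nrm X L" and r0: "r0 > eps0 nrm X L / (2 * L)" and "0 < \<gamma>"
    and dens: "\<And>x r. x \<in> X \<Longrightarrow> 0 < r \<Longrightarrow> r < r0 \<Longrightarrow>
           vol (nball nrm x r \<inter> X) \<ge> \<gamma> * ball_vol nrm r"
  shows "real (S_C nrm X L f e) * (\<gamma> * ball_vol nrm (1 / (128 * L)))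
    \<le> (LINT x:X|lebesgue. 1 / (f xstar - f x + e) ^ CARD('n))"
proof -
  define M where "M = num_layers (eps0 nrm X L) e"
  define s where "s = eps_seq (eps0 nrm X L) e"
  define K where "K t = {k \<in> {1..M}. s k / 2 < t \<and> t \<le> 5 / 2 * s k}" for t
  let ?d = "CARD('n)" and ?W = "\<gamma> * ball_vol nrm (1 / (128 * L))"
  let ?B = "near_opt X f (3 / 2 * e)" and ?A = "\<lambda>k. layer X f (s k / 2) (5 / 2 * s k)"
  have s_ge: "s k \<ge> e" and s_le: "s k \<le> eps0 nrm X L" for k
    using eps_seq_ge[OF e, of k] eps_seq_le_eps0[OF e, of k] by (simp_all add: s_def)
  have s_pos: "s k > 0" for k
    using s_ge[of k] e(1) by simp
  \<comment> \<open>The density hypothesis applies to all balls used, as their radii are at most half the diameter.\<close>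
  have radius: "t / (2 * L) < r0" if "t \<le> eps0 nrm X L" for t
    using divide_right_mono[OF that, of "2 * L"] r0 L by simp
  have pointwise: "indicator ?B x * (1 / (7 / 2 * e) ^ ?d)
        + (\<Sum>k = 1..M. indicator (?A k) x * (1 / (7 / 2 * s k) ^ ?d))
      \<le> 5 * (indicator X x *\<^sub>R (1 / (f xstar - f x + e) ^ ?d))"
    for x
  proof (cases "x \<in> X")
    case True
    define t where "t = f xstar - f x"
    define p where "p = 1 / (t + e) ^ ?d"
    have t0: "t \<ge> 0"
      using xstar(2)[OF True] by (simp add: t_def)
    have p0: "p \<ge> 0" using t0 e by (simp add: p_def)
    have summand_le: "1 / (7 / 2 * u) ^ ?d \<le> p" if "t + e \<le> 7 / 2 * u" for u
      unfolding p_def using that t0 e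
      by (intro divide_left_mono power_mono mult_pos_pos zero_less_power) auto
    have "indicator ?B x * (1 / (7 / 2 * e) ^ ?d) \<le> p"
      using summand_le[of e] p0 e(1) by (auto simp: indicator_def near_opt_def max_on_eq t_def)
    moreover have "(\<Sum>k = 1..M. indicator (?A k) x * (1 / (7 / 2 * s k) ^ ?d)) \<le> 4 * p"
    proof -
      have "(\<Sum>k = 1..M. indicator (?A k) x * (1 / (7 / 2 * s k) ^ ?d))
          \<le> (\<Sum>k = 1..M. if k \<in> K t then p else 0)"
      proof (rule sum_mono)
        fix k assume "k \<in> {1..M}"
        then show "indicator (?A k) x * (1 / (7 / 2 * s k) ^ ?d) \<le> (if k \<in> K t then p else 0)"
          using summand_le[of "s k"] s_ge[of k] True
          by (auto simp: indicator_def layer_def max_on_eq t_def K_def)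
      qed
      also have "\<dots> = real (card (K t)) * p"
        by (simp add: K_def flip: sum.inter_filter)
      also have "\<dots> \<le> 4 * p"
        using card_enlarged_layers_le[OF e, of t] p0
        by (intro mult_right_mono) (simp_all add: K_def M_def s_def)
      finally show ?thesis .
    qed
    ultimately show ?thesis
      using True by (simp add: p_def t_def)
  qed (auto simp: near_opt_def layer_def)
  have near: "real (packing_number nrm (near_opt X f e) (e / L)) * ?W
      \<le> 1 / 5 * (vol ?B * (1 / (7 / 2 * e) ^ ?d))"
  proof (rule packing_mult_le_vol_enlarged[OF e(1) radius[OF e(2)] \<open>0 < \<gamma>\<close> dens])
    fix x y assume "x \<in> near_opt X f e" "y \<in> X" "\<bar>f x - f y\<bar> \<le> e / 2"
    then show "y \<in> ?B"
      unfolding near_opt_def mem_Collect_eq by linarith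
  qed (assumption | rule near_opt_subset lmeasurable_near_opt)+
  have layer: "real (packing_number nrm (layer X f (s k) (s (k - 1))) (s k / L)) * ?W
      \<le> 1 / 5 * (vol (?A k) * (1 / (7 / 2 * s k) ^ ?d))" if k: "k \<in> {1..M}" for k
  proof (rule packing_mult_le_vol_enlarged[OF s_pos radius[OF s_le] \<open>0 < \<gamma>\<close> dens])
    have "s (k - 1) \<le> 2 * s k"
      using eps_seq_pred_le[OF e, of k] k by (simp add: s_def M_def)
    moreover fix x y assume "x \<in> layer X f (s k) (s (k - 1))" "y \<in> X" "\<bar>f x - f y\<bar> \<le> s k / 2"
    ultimately show "y \<in> ?A k"
      unfolding layer_def mem_Collect_eq by linarith
  qed (assumption | rule layer_subset lmeasurable_layer)+
  have "real (S_C nrm X L f e) * ?W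
    = real (packing_number nrm (near_opt X f e) (e / L)) * ?W
      + (\<Sum>k = 1..M. real (packing_number nrm (layer X f (s k) (s (k - 1))) (s k / L)) * ?W)"
    by (simp add: S_C_def Let_def s_def M_def distrib_right sum_distrib_right)
  also have "\<dots> \<le> 1 / 5 * (vol ?B * (1 / (7 / 2 * e) ^ ?d))
      + (\<Sum>k = 1..M. 1 / 5 * (vol (?A k) * (1 / (7 / 2 * s k) ^ ?d)))"
    by (intro add_mono near sum_mono layer)
  also have "\<dots> = 1 / 5 * (vol ?B * (1 / (7 / 2 * e) ^ ?d)
      + (\<Sum>k = 1..M. vol (?A k) * (1 / (7 / 2 * s k) ^ ?d)))"
    by (simp only: distrib_left sum_distrib_left)
  also have "vol ?B * (1 / (7 / 2 * e) ^ ?d) + (\<Sum>k = 1..M. vol (?A k) * (1 / (7 / 2 * s k) ^ ?d))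
    \<le> (\<integral>x. 5 * (indicator X x *\<^sub>R (1 / (f xstar - f x + e) ^ ?d)) \<partial>lebesgue)"
    unfolding integral_steps[symmetric]
    by (intro integral_mono pointwise integrable_steps integrable_mult_right
        set_integrable_regret[OF e(1), unfolded set_integrable_def])
  also have "\<dots> = 5 * (LINT x:X|lebesgue. 1 / (f xstar - f x + e) ^ ?d)"
    unfolding set_lebesgue_integral_def by (rule integral_mult_right_zero)
  finally show ?thesis by simp
qed

end

theorem theorem1:
  fixes X :: "(real ^ 'n) set"
    and nrm :: "real ^ 'n \<Rightarrow> real"
    and f :: "real ^ 'n \<Rightarrow> real"
    and xstar :: "real ^ 'n"
    and L r0 \<gamma> :: real
  assumes "X \<noteq> {}" and "compact X"
    and "is_norm nrm"
    and "L > 0"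
    and "f \<in> lip_class nrm X L"
    and "xstar \<in> X" and "\<And>x. x \<in> X \<Longrightarrow> f x \<le> f xstar"
    and "r0 > eps0 nrm X L / (2 * L)"
    and "0 < \<gamma>" and "\<gamma> \<le> 1"
    and "\<And>x r. x \<in> X \<Longrightarrow> 0 < r \<Longrightarrow> r < r0 \<Longrightarrow>
           vol (nball nrm x r \<inter> X) \<ge> \<gamma> * ball_vol nrm r"
  shows "\<exists>c>0. \<exists>C>0.
           c = 1 / ball_vol nrm (1 / L) \<and>
           C = 1 / (\<gamma> * ball_vol nrm (1 / (128 * L))) \<and>
           (\<forall>\<epsilon>. 0 < \<epsilon> \<and> \<epsilon> \<le> eps0 nrm X L \<longrightarrow>
              c * (LINT x:X|lebesgue. 1 / (f xstar - f x + \<epsilon>) ^ CARD('n)) \<le> real (S_C nrm X L f \<epsilon>) \<and>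
              real (S_C nrm X L f \<epsilon>) \<le> C * (LINT x:X|lebesgue. 1 / (f xstar - f x + \<epsilon>) ^ CARD('n)))"
proof -
  note lip = lip_class_imp_le[OF \<open>is_norm nrm\<close> \<open>f \<in> lip_class nrm X L\<close>]
  note setting = \<open>compact X\<close> \<open>is_norm nrm\<close> \<open>L > 0\<close> lip \<open>xstar \<in> X\<close> assms(7)
  let ?c = "1 / ball_vol nrm (1 / L)" and ?C = "1 / (\<gamma> * ball_vol nrm (1 / (128 * L)))"
  let ?I = "\<lambda>\<epsilon>. LINT x:X|lebesgue. 1 / (f xstar - f x + \<epsilon>) ^ CARD('n)"
  have pos: "ball_vol nrm (1 / L) > 0" "\<gamma> * ball_vol nrm (1 / (128 * L)) > 0"
    using \<open>L > 0\<close> \<open>0 < \<gamma>\<close> by (auto intro!: mult_pos_pos ball_vol_pos[OF \<open>is_norm nrm\<close>])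
  have "?c * ?I \<epsilon> \<le> real (S_C nrm X L f \<epsilon>)" "real (S_C nrm X L f \<epsilon>) \<le> ?C * ?I \<epsilon>"
    if \<epsilon>: "0 < \<epsilon>" "\<epsilon> \<le> eps0 nrm X L" for \<epsilon>
    using integral_le_S_C[OF setting \<epsilon>] S_C_le_integral[OF setting \<epsilon> assms(8,9,11)] pos
    by (simp_all add: pos_divide_le_eq pos_le_divide_eq)
  moreover have "?c > 0" "?C > 0"
    using pos by simp_all
  ultimately show ?thesis
    by blast
qed

end
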